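(* Let $\mathcal H$ be a real separable infinite-dimensional Hilbert space, let $X,Y$ be $\mathcal H$-valued random variables and let $\tilde X=X+U_X$, $\tilde Y=Y+U_Y$, where $U_X,U_Y$ are independent $\mathcal H$-valued random variables, independent of $(X,Y)$, whose characteristic functionals $\varphi_{U_X},\varphi_{U_Y}$ do not vanish, i.e. $\varphi_{U_X}(w)\varphi_{U_Y}(w)\ne0$ for every $w\in\mathcal H$. If $\nu$ is a characteristic reference probability measure on $\mathcal H$, then \begin{align*} \operatorname{Ed}_\nu^2(\mathbb P^{\tilde X},\mathbb P^{\tilde Y})=0&\ \text{ if and only if }\ \operatorname{Ed}_\nu^2(\mathbb P^X,\mathbb P^Y)=0,\quad\text{when }\varphi_{U_X}=\varphi_{U_Y};\\ \operatorname{dCov}_\nu^2(\tilde X,\tilde Y)=0&\ \text{ if and only if }\ \operatorname{dCov}_\nu^2(X,Y)=0. \end{align*}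
   Context: $\langle\cdot,\cdot\rangle$ is the inner product of $\mathcal H$ and $\mathbb P^Z$ denotes the distribution of $Z$. For $\mathcal H$-valued $Z,W$: $\varphi_Z(w)=\mathbb E e^{\mathrm i\langle Z,w\rangle}$ and $\varphi_{Z,W}(w_1,w_2)=\mathbb E e^{\mathrm i\langle Z,w_1\rangle+\mathrm i\langle W,w_2\rangle}$. For a Borel probability measure $\nu$ on $\mathcal H$: $$\operatorname{Ed}_\nu^2(\mathbb P^Z,\mathbb P^W)=\int_{\mathcal H}|\varphi_Z-\varphi_W|^2\,\mathrm d\nu,\qquad\operatorname{dCov}_\nu^2(Z,W)=\int_{\mathcal H^2}|\varphi_{Z,W}(w_1,w_2)-\varphi_Z(w_1)\varphi_W(w_2)|^2\,\nu(\mathrm dw_1)\nu(\mathrm dw_2).$$ A reference probability measure is a Borel probability measure $\nu$ on $\mathcal H$ that is symmetric ($\nu(B)=\nu(-B)$ for all Borel $B$) with $\operatorname{supp}(\nu)=\mathcal H$. $\nu$ is characteristic if for all Borel probability measures $\mathbb P,\mathbb Q$ on $\mathcal H$, $\operatorname{Ed}_\nu^2(\mathbb P,\mathbb Q)=0$ if and only if $\mathbb P=\mathbb Q$. *)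

theory Defs
  imports "HOL-Probability.Probability"
begin

text \<open>
  A real separable Hilbert space is a type of sort
  \<open>{real_inner, complete_space, second_countable_topology}\<close>; for metric spaces,
  second countability is the same as separability.
\<close>

definition infinite_dimensional :: "'h::real_vector itself \<Rightarrow> bool" where
  "infinite_dimensional _ \<longleftrightarrow> (\<forall>B::'h set. finite B \<longrightarrow> span B \<noteq> UNIV)"

definition borel_prob :: "'h::topological_space measure \<Rightarrow> bool" where
  "borel_prob P \<longleftrightarrow> prob_space P \<and> sets P = sets borel"

definition char_functional :: "'a measure \<Rightarrow> ('a \<Rightarrow> 'h::real_inner) \<Rightarrow> 'h \<Rightarrow> complex" where
  "char_functional M Z w = (CLINT x|M. iexp (Z x \<bullet> w))"

definition joint_char_functional ::
  "'a measure \<Rightarrow> ('a \<Rightarrow> 'h::real_inner) \<Rightarrow> ('a \<Rightarrow> 'h) \<Rightarrow> 'h \<Rightarrow> 'h \<Rightarrow> complex" where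
  "joint_char_functional M Z W w1 w2 = (CLINT x|M. exp (\<i> * of_real (Z x \<bullet> w1) + \<i> * of_real (W x \<bullet> w2)))"

text \<open>
  The energy distance takes two laws on \<open>'h\<close>. The characteristic functional of a law \<open>P\<close>
  is that of the identity, regarded as a random variable on the probability space \<open>P\<close>.

  For probability measures, the integrands of both distances below are continuous with values
  in \<open>[0, 4]\<close>, so the Bochner integrals are never a default value.
\<close>

definition energy_dist2 ::
  "'h::{real_inner, second_countable_topology} measure \<Rightarrow> 'h measure \<Rightarrow> 'h measure \<Rightarrow> real" where
  "energy_dist2 \<nu> P Q =
     (LINT w|\<nu>. (cmod (char_functional P (\<lambda>x. x) w - char_functional Q (\<lambda>x. x) w))\<^sup>2)"

definition dist_cov2 ::
  "'h::{real_inner, second_countable_topology} measure \<Rightarrow> 'a measure \<Rightarrow> ('a \<Rightarrow> 'h) \<Rightarrow> ('a \<Rightarrow> 'h) \<Rightarrow> real" where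
  "dist_cov2 \<nu> M Z W =
     (LINT (w1, w2)|(\<nu> \<Otimes>\<^sub>M \<nu>).
        (cmod (joint_char_functional M Z W w1 w2 - char_functional M Z w1 * char_functional M W w2))\<^sup>2)"

definition measure_supp :: "'h::topological_space measure \<Rightarrow> 'h set" where
  "measure_supp \<nu> = {x. \<forall>U. open U \<longrightarrow> x \<in> U \<longrightarrow> emeasure \<nu> U > 0}"

definition reference_prob :: "'h::real_inner measure \<Rightarrow> bool" where
  "reference_prob \<nu> \<longleftrightarrow>
     borel_prob \<nu> \<and>
     (\<forall>B\<in>sets borel. emeasure \<nu> B = emeasure \<nu> (uminus ` B)) \<and>
     measure_supp \<nu> = UNIV"

definition characteristic_measure :: "'h::{real_inner, second_countable_topology} measure \<Rightarrow> bool" where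
  "characteristic_measure \<nu> \<longleftrightarrow>
     (\<forall>P Q. borel_prob P \<longrightarrow> borel_prob Q \<longrightarrow> (energy_dist2 \<nu> P Q = 0 \<longleftrightarrow> P = Q))"

end

theory Submission
  imports Defs
begin

text \<open>
  Independent noise acts on characteristic functionals by multiplication:
  \<open>\<phi>(X+U, Y+V)(w1, w2) = \<phi>(X, Y)(w1, w2) * \<phi>U(w1) * \<phi>V(w2)\<close>. Setting one argument to \<open>0\<close> gives the
  factorisation of the marginals. Hence the function under \<open>dCov\<close> for the noisy pair is the one for
  the noiseless pair times \<open>\<phi>U(w1) * \<phi>V(w2)\<close>, and, when both noises have the same characteristic
  functional, the difference under \<open>Ed\<close> is multiplied by \<open>\<phi>U(w)\<close>. These factors vanish nowhere, so the
  integrands with and without noise have the same zero set. A nonnegative integrable function has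
  integral zero exactly when it vanishes almost everywhere, so only this zero set matters.
  The remaining point is integrability of the integrands: they are bounded, and they are measurable
  because they are parameter integrals of jointly measurable functions.
\<close>

section \<open>Vanishing of integrals of squared moduli\<close>

lemma (in finite_measure) integral_norm_square_eq_0_iff_AE:
  fixes g :: "'a \<Rightarrow> 'b::{real_normed_vector, second_countable_topology}"
  assumes "g \<in> borel_measurable M" and bound: "\<And>x. norm (g x) \<le> C"
  shows "(LINT x|M. (norm (g x))\<^sup>2) = 0 \<longleftrightarrow> (AE x in M. g x = 0)"
proof -
  have "integrable M (\<lambda>x. (norm (g x))\<^sup>2)"
  proof (rule integrable_const_bound)
    show "AE x in M. norm ((norm (g x))\<^sup>2) \<le> C\<^sup>2"
      using bound by (auto intro!: power_mono)
    show "(\<lambda>x. (norm (g x))\<^sup>2) \<in> borel_measurable M"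
      using assms(1) by measurable
  qed
  then show ?thesis
    by (subst integral_nonneg_eq_0_iff_AE) auto
qed

lemma (in finite_measure) integral_norm_square_eq_0_cong:
  fixes g h :: "'a \<Rightarrow> 'b::{real_normed_vector, second_countable_topology}"
  assumes "g \<in> borel_measurable M" "\<And>x. norm (g x) \<le> C"
    and "h \<in> borel_measurable M" "\<And>x. norm (h x) \<le> D"
    and "\<And>x. g x = 0 \<longleftrightarrow> h x = 0"
  shows "(LINT x|M. (norm (g x))\<^sup>2) = 0 \<longleftrightarrow> (LINT x|M. (norm (h x))\<^sup>2) = 0"
  using assms by (simp add: integral_norm_square_eq_0_iff_AE[of _ C] integral_norm_square_eq_0_iff_AE[of _ D])

section \<open>Characteristic functionals as functions of their arguments\<close>

lemma char_functional_eq_joint: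
  "char_functional M Z w = joint_char_functional M Z W w 0"
  "char_functional M W w = joint_char_functional M Z W 0 w"
  by (simp_all add: char_functional_def joint_char_functional_def)

lemma char_functional_0:
  assumes "prob_space M"
  shows "char_functional M Z 0 = 1"
  using assms by (simp add: char_functional_def prob_space.prob_space)

lemma (in prob_space) integrable_exp_inner:
  fixes Z W :: "'a \<Rightarrow> 'h::{real_inner, second_countable_topology}"
  assumes [measurable]: "Z \<in> borel_measurable M" "W \<in> borel_measurable M"
  shows "integrable M (\<lambda>x. exp (\<i> * complex_of_real (Z x \<bullet> w1) + \<i> * complex_of_real (W x \<bullet> w2)))"
  by (rule integrable_const_bound[of _ 1]) auto

lemma (in prob_space) norm_joint_char_functional_le_1:
  fixes Z W :: "'a \<Rightarrow> 'h::{real_inner, second_countable_topology}"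
  assumes [measurable]: "Z \<in> borel_measurable M" "W \<in> borel_measurable M"
  shows "cmod (joint_char_functional M Z W w1 w2) \<le> 1"
proof -
  have "cmod (joint_char_functional M Z W w1 w2)
      \<le> (\<integral>x. cmod (exp (\<i> * complex_of_real (Z x \<bullet> w1) + \<i> * complex_of_real (W x \<bullet> w2))) \<partial>M)"
    unfolding joint_char_functional_def by (rule integral_norm_bound)
  then show ?thesis
    by (simp add: prob_space)
qed

lemma (in prob_space) norm_char_functional_le_1:
  fixes Z :: "'a \<Rightarrow> 'h::{real_inner, second_countable_topology}"
  assumes "Z \<in> borel_measurable M"
  shows "cmod (char_functional M Z w) \<le> 1"
  using norm_joint_char_functional_le_1[OF assms assms] by (simp add: char_functional_eq_joint(1)[where W = Z])

lemma (in prob_space) borel_measurable_joint_char_functional: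
  fixes Z W :: "'a \<Rightarrow> 'h::{real_inner, second_countable_topology}"
  assumes [measurable]: "Z \<in> borel_measurable M" "W \<in> borel_measurable M"
    and [measurable]: "f \<in> borel_measurable N" "g \<in> borel_measurable N"
  shows "(\<lambda>v. joint_char_functional M Z W (f v) (g v)) \<in> borel_measurable N"
  unfolding joint_char_functional_def
  by (rule borel_measurable_lebesgue_integral) measurable

lemma (in prob_space) borel_measurable_char_functional:
  fixes Z :: "'a \<Rightarrow> 'h::{real_inner, second_countable_topology}"
  assumes "Z \<in> borel_measurable M" and "f \<in> borel_measurable N"
  shows "(\<lambda>v. char_functional M Z (f v)) \<in> borel_measurable N"
  unfolding char_functional_eq_joint(1)[where W = Z]
  using assms by (intro borel_measurable_joint_char_functional) auto

lemma char_functional_distr: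
  fixes Z :: "'a \<Rightarrow> 'h::{real_inner, second_countable_topology}"
  assumes "Z \<in> borel_measurable M"
  shows "char_functional (distr M borel Z) (\<lambda>x. x) = char_functional M Z"
  unfolding char_functional_def using assms by (auto simp: integral_distr)

section \<open>Independent noise multiplies characteristic functionals\<close>

lemma (in prob_space) joint_char_functional_indep:
  fixes U V :: "'a \<Rightarrow> 'h::{real_inner, second_countable_topology}"
  assumes [measurable]: "U \<in> borel_measurable M" "V \<in> borel_measurable M"
    and "indep_var borel U borel V"
  shows "joint_char_functional M U V w1 w2 = char_functional M U w1 * char_functional M V w2"
proof -
  have "indep_var borel ((\<lambda>u. iexp (u \<bullet> w1)) \<circ> U) borel ((\<lambda>v. iexp (v \<bullet> w2)) \<circ> V)"
    by (rule indep_var_compose[OF assms(3)]) measurable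
  moreover have "integrable M (\<lambda>x. iexp (U x \<bullet> w1))" "integrable M (\<lambda>x. iexp (V x \<bullet> w2))"
    using integrable_exp_inner[of U V w1 0] integrable_exp_inner[of U V 0 w2] by simp_all
  ultimately show ?thesis
    unfolding joint_char_functional_def char_functional_def
    using indep_var_lebesgue_integral[of "\<lambda>x. iexp (U x \<bullet> w1)" "\<lambda>x. iexp (V x \<bullet> w2)"]
    by (simp add: exp_add comp_def)
qed

text \<open>
  The integrand for the noisy pair is the product of a function of the noise pair and a function of
  the signal pair, so independence of the two pairs alone splits the expectation; the factor for
  \<open>(U, V)\<close> is still a joint functional.
\<close>

lemma (in prob_space) joint_char_functional_add:
  fixes X Y U V :: "'a \<Rightarrow> 'h::{real_inner, second_countable_topology}"
  assumes [measurable]: "X \<in> borel_measurable M" "Y \<in> borel_measurable M"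
      "U \<in> borel_measurable M" "V \<in> borel_measurable M"
    and indep: "indep_var (borel \<Otimes>\<^sub>M borel) (\<lambda>x. (U x, V x)) (borel \<Otimes>\<^sub>M borel) (\<lambda>x. (X x, Y x))"
  shows "joint_char_functional M (\<lambda>x. X x + U x) (\<lambda>x. Y x + V x) w1 w2
    = joint_char_functional M X Y w1 w2 * joint_char_functional M U V w1 w2"
proof -
  let ?e = "\<lambda>(a::'h, b::'h). exp (\<i> * complex_of_real (a \<bullet> w1) + \<i> * complex_of_real (b \<bullet> w2))"
  have "indep_var borel (?e \<circ> (\<lambda>x. (U x, V x))) borel (?e \<circ> (\<lambda>x. (X x, Y x)))"
    by (rule indep_var_compose[OF indep]) measurable
  then have "(CLINT x|M. ?e (U x, V x) * ?e (X x, Y x))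
      = (CLINT x|M. ?e (U x, V x)) * (CLINT x|M. ?e (X x, Y x))"
    using integrable_exp_inner[of U V w1 w2] integrable_exp_inner[of X Y w1 w2]
    by (intro indep_var_lebesgue_integral) (simp_all add: comp_def)
  moreover have "exp (\<i> * complex_of_real ((X x + U x) \<bullet> w1) + \<i> * complex_of_real ((Y x + V x) \<bullet> w2))
      = ?e (U x, V x) * ?e (X x, Y x)" for x
    by (simp add: inner_add_left exp_add[symmetric] algebra_simps)
  ultimately show ?thesis
    unfolding joint_char_functional_def by (simp add: mult.commute)
qed

section \<open>Distances under independent noise\<close>

theorem proposition4p9:
  fixes M :: "'a measure"
    and X Y U\<^sub>X U\<^sub>Y :: "'a \<Rightarrow> 'h::{real_inner, complete_space, second_countable_topology}"
    and \<nu> :: "'h measure"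
  assumes "infinite_dimensional TYPE('h)"
    and "prob_space M"
    and "X \<in> borel_measurable M" and "Y \<in> borel_measurable M"
    and "U\<^sub>X \<in> borel_measurable M" and "U\<^sub>Y \<in> borel_measurable M"
    and "prob_space.indep_var M borel U\<^sub>X borel U\<^sub>Y"
    and "prob_space.indep_var M
           (borel \<Otimes>\<^sub>M borel) (\<lambda>\<omega>. (U\<^sub>X \<omega>, U\<^sub>Y \<omega>))
           (borel \<Otimes>\<^sub>M borel) (\<lambda>\<omega>. (X \<omega>, Y \<omega>))"
    and "\<And>w. char_functional M U\<^sub>X w * char_functional M U\<^sub>Y w \<noteq> 0"
    and "reference_prob \<nu>" and "characteristic_measure \<nu>"
  shows "(char_functional M U\<^sub>X = char_functional M U\<^sub>Y \<longrightarrow>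
            (energy_dist2 \<nu> (distr M borel (\<lambda>\<omega>. X \<omega> + U\<^sub>X \<omega>)) (distr M borel (\<lambda>\<omega>. Y \<omega> + U\<^sub>Y \<omega>)) = 0
             \<longleftrightarrow> energy_dist2 \<nu> (distr M borel X) (distr M borel Y) = 0))
         \<and> (dist_cov2 \<nu> M (\<lambda>\<omega>. X \<omega> + U\<^sub>X \<omega>) (\<lambda>\<omega>. Y \<omega> + U\<^sub>Y \<omega>) = 0
             \<longleftrightarrow> dist_cov2 \<nu> M X Y = 0)"
proof -
  interpret prob_space M by fact
  note [measurable] = assms(3-6)
  have \<nu>: "prob_space \<nu>" and sets_\<nu> [measurable_cong]: "sets \<nu> = sets borel"
    using \<open>reference_prob \<nu>\<close> by (auto simp: reference_prob_def borel_prob_def)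
  interpret \<nu>: prob_space \<nu> by (rule \<nu>)
  interpret \<nu>2: pair_prob_space \<nu> \<nu> ..
  let ?X = "\<lambda>\<omega>. X \<omega> + U\<^sub>X \<omega>" and ?Y = "\<lambda>\<omega>. Y \<omega> + U\<^sub>Y \<omega>"
  let ?\<phi> = "char_functional M"
  have nonzero: "?\<phi> U\<^sub>X w \<noteq> 0" "?\<phi> U\<^sub>Y w \<noteq> 0" for w
    using assms(9)[of w] by auto
  have joint: "joint_char_functional M ?X ?Y w1 w2
      = joint_char_functional M X Y w1 w2 * (?\<phi> U\<^sub>X w1 * ?\<phi> U\<^sub>Y w2)" for w1 w2
    using assms(3-8) by (simp add: joint_char_functional_add joint_char_functional_indep)
  have marginal_X: "?\<phi> ?X w = ?\<phi> X w * ?\<phi> U\<^sub>X w" for w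
    using joint[of w 0] by (simp add: char_functional_eq_joint(1)[symmetric] char_functional_0 assms(2))
  have marginal_Y: "?\<phi> ?Y w = ?\<phi> Y w * ?\<phi> U\<^sub>Y w" for w
    using joint[of 0 w] by (simp add: char_functional_eq_joint(2)[symmetric] char_functional_0 assms(2))

  have diff_bound: "cmod (?\<phi> Z w - ?\<phi> W w) \<le> 2"
    if "Z \<in> borel_measurable M" "W \<in> borel_measurable M" for Z W :: "'a \<Rightarrow> 'h" and w
    using norm_triangle_ineq4[of "?\<phi> Z w" "?\<phi> W w"]
      norm_char_functional_le_1[OF that(1), of w] norm_char_functional_le_1[OF that(2), of w]
    by linarith
  have cov_bound: "cmod (joint_char_functional M Z W w1 w2 - ?\<phi> Z w1 * ?\<phi> W w2) \<le> 2"
    if "Z \<in> borel_measurable M" "W \<in> borel_measurable M" for Z W :: "'a \<Rightarrow> 'h" and w1 w2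
  proof -
    have "cmod (?\<phi> Z w1 * ?\<phi> W w2) \<le> 1"
      using that by (auto simp: norm_mult intro!: mult_le_one norm_char_functional_le_1)
    then show ?thesis
      using norm_triangle_ineq4[of "joint_char_functional M Z W w1 w2" "?\<phi> Z w1 * ?\<phi> W w2"]
        norm_joint_char_functional_le_1[OF that, of w1 w2]
      by linarith
  qed

  have "energy_dist2 \<nu> (distr M borel ?X) (distr M borel ?Y) = 0
      \<longleftrightarrow> energy_dist2 \<nu> (distr M borel X) (distr M borel Y) = 0"
    if same: "?\<phi> U\<^sub>X = ?\<phi> U\<^sub>Y"
  proof -
    have "?\<phi> ?X w - ?\<phi> ?Y w = (?\<phi> X w - ?\<phi> Y w) * ?\<phi> U\<^sub>Y w" for w
      by (simp add: marginal_X marginal_Y same left_diff_distrib)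
    then have zeros: "?\<phi> ?X w - ?\<phi> ?Y w = 0 \<longleftrightarrow> ?\<phi> X w - ?\<phi> Y w = 0" for w
      using nonzero by simp
    have "(LINT w|\<nu>. (cmod (?\<phi> ?X w - ?\<phi> ?Y w))\<^sup>2) = 0
        \<longleftrightarrow> (LINT w|\<nu>. (cmod (?\<phi> X w - ?\<phi> Y w))\<^sup>2) = 0"
      by (rule \<nu>.integral_norm_square_eq_0_cong[OF _ diff_bound _ diff_bound zeros])
        (auto intro!: borel_measurable_diff borel_measurable_char_functional)
    then show ?thesis
      by (simp add: energy_dist2_def char_functional_distr)
  qed
  moreover have "dist_cov2 \<nu> M ?X ?Y = 0 \<longleftrightarrow> dist_cov2 \<nu> M X Y = 0"
  proof -
    define D where "D Z W v =
        joint_char_functional M Z W (fst v) (snd v) - ?\<phi> Z (fst v) * ?\<phi> W (snd v)"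
      for Z W :: "'a \<Rightarrow> 'h" and v
    have projections: "fst \<in> borel_measurable (\<nu> \<Otimes>\<^sub>M \<nu>)" "snd \<in> borel_measurable (\<nu> \<Otimes>\<^sub>M \<nu>)"
      using measurable_fst[of \<nu> \<nu>] measurable_snd[of \<nu> \<nu>] measurable_cong_sets[OF refl sets_\<nu>]
      by blast+
    have D_measurable: "D Z W \<in> borel_measurable (\<nu> \<Otimes>\<^sub>M \<nu>)"
      if "Z \<in> borel_measurable M" "W \<in> borel_measurable M" for Z W
      unfolding D_def using that projections
      by (intro borel_measurable_diff borel_measurable_times borel_measurable_joint_char_functional
          borel_measurable_char_functional)
    have D_bound: "cmod (D Z W v) \<le> 2"
      if "Z \<in> borel_measurable M" "W \<in> borel_measurable M" for Z W v
      unfolding D_def using that by (rule cov_bound)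
    have "D ?X ?Y v = D X Y v * (?\<phi> U\<^sub>X (fst v) * ?\<phi> U\<^sub>Y (snd v))" for v
      by (simp add: D_def joint marginal_X marginal_Y left_diff_distrib right_diff_distrib mult_ac)
    then have zeros: "D ?X ?Y v = 0 \<longleftrightarrow> D X Y v = 0" for v
      using nonzero by simp
    have "(LINT v|(\<nu> \<Otimes>\<^sub>M \<nu>). (cmod (D ?X ?Y v))\<^sup>2) = 0
        \<longleftrightarrow> (LINT v|(\<nu> \<Otimes>\<^sub>M \<nu>). (cmod (D X Y v))\<^sup>2) = 0"
      by (rule \<nu>2.integral_norm_square_eq_0_cong[OF D_measurable D_bound D_measurable D_bound zeros])
        measurable
    then show ?thesis
      by (simp add: dist_cov2_def D_def case_prod_unfold)
  qed
  ultimately show ?thesis by blast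
qed

end
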